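(* Let $\beta>0$ and let $g$ be a function on $(0,\beta]$ which is integrable on $[\delta,\beta]$ for every $0<\delta<\beta$. If the conventional improper integral $\int_0^\beta g(u)\,du=\lim_{\delta\to0^+}\int_\delta^\beta g(u)\,du$ exists, then the generalized improper integral $Z\!\!\int_0^\beta g(u)\,du$ exists and $$Z\!\!\int_0^\beta g(u)\,du=\int_0^\beta g(u)\,du .$$
   Context: Initialization function: a finite real-valued function $w$ on $\mathbb{R}$ for which there is $\epsilon$ with $0<\epsilon\le 1$ such that $w(v)=0$ for $v<\epsilon$, $w(v)=1$ for $v\ge 1$, and $w'(v)\ge 0$ (i.e. $w$ is nondecreasing; $w'$ need not exist classically everywhere). Generalized improper integral (critical lower limit $0$, noncritical upper limit $\beta$): for an initialization function $w$ (not depending on $\delta$), $$Z\!\!\int_{0}^{\beta} g(u)\,du = \lim_{\delta\to 0^+}\left\{\int_0^\delta g(u)\,w(u/\delta)\,du+\int_\delta^\beta g(u)\,du\right\},$$ where the integrals inside the limit are conventional ones (since $w(u/\delta)=0$ for $u<\epsilon\delta$, the first is effectively over $[\epsilon\delta,\delta]$). The integral is said to exist if the limit exists (as a finite number) for some initialization function $w$, and its value is that limit; the value is the same for all initialization functions for which the limit exists. *)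

theory Defs
  imports "HOL-Analysis.Analysis"
begin

text \<open>
  Conventional integrals are Henstock--Kurzweil integrals (\<open>integrable_on\<close>, \<open>integral\<close>), which
  extend both the Riemann and the Lebesgue integral on compact intervals. A function on
  \<open>(0, \<beta>]\<close> is a total function \<open>real \<Rightarrow> real\<close>; its values outside \<open>(0, \<beta>]\<close> play no role.
\<close>

definition initialization_function :: "(real \<Rightarrow> real) \<Rightarrow> bool" where
  "initialization_function w \<longleftrightarrow>
     mono w \<and> (\<exists>\<epsilon>. 0 < \<epsilon> \<and> \<epsilon> \<le> 1 \<and> (\<forall>v<\<epsilon>. w v = 0) \<and> (\<forall>v\<ge>1. w v = 1))"

definition improper_integrable :: "real \<Rightarrow> (real \<Rightarrow> real) \<Rightarrow> bool" where
  "improper_integrable \<beta> g \<longleftrightarrow>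
     (\<forall>\<^sub>F \<delta> in at_right 0. g integrable_on {\<delta>..\<beta>}) \<and>
     (\<exists>L. ((\<lambda>\<delta>. integral {\<delta>..\<beta>} g) \<longlongrightarrow> L) (at_right 0))"

definition improper_integral :: "real \<Rightarrow> (real \<Rightarrow> real) \<Rightarrow> real" where
  "improper_integral \<beta> g = Lim (at_right 0) (\<lambda>\<delta>. integral {\<delta>..\<beta>} g)"

text \<open>
  Since \<open>integral\<close> is total (0 on non-integrable functions), the existence of the integrals
  under the limit is required explicitly, for all sufficiently small \<open>\<delta> > 0\<close>.
\<close>

definition has_Z_integral_via ::
    "(real \<Rightarrow> real) \<Rightarrow> real \<Rightarrow> (real \<Rightarrow> real) \<Rightarrow> real \<Rightarrow> bool" where
  "has_Z_integral_via w \<beta> g L \<longleftrightarrow>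
     (\<forall>\<^sub>F \<delta> in at_right 0. (\<lambda>u. g u * w (u / \<delta>)) integrable_on {0..\<delta>} \<and>
                         g integrable_on {\<delta>..\<beta>}) \<and>
     ((\<lambda>\<delta>. integral {0..\<delta>} (\<lambda>u. g u * w (u / \<delta>)) + integral {\<delta>..\<beta>} g) \<longlongrightarrow> L) (at_right 0)"

definition Z_integrable :: "real \<Rightarrow> (real \<Rightarrow> real) \<Rightarrow> bool" where
  "Z_integrable \<beta> g \<longleftrightarrow> (\<exists>w L. initialization_function w \<and> has_Z_integral_via w \<beta> g L)"

definition Z_integral :: "real \<Rightarrow> (real \<Rightarrow> real) \<Rightarrow> real" where
  "Z_integral \<beta> g = (THE L. \<exists>w. initialization_function w \<and> has_Z_integral_via w \<beta> g L)"

end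

theory Submission
  imports Defs
begin

text \<open>
  Write \<open>F \<delta> = integral {\<delta>..\<beta>} g\<close>. Since \<open>w\<close> is monotone, vanishes below \<open>\<epsilon>\<close> and is \<open>1\<close> at \<open>1\<close>, the
  second mean value theorem turns the weighted part into an unweighted integral of \<open>g\<close> over some
  \<open>{c..\<delta>}\<close> with \<open>0 < c \<le> \<delta>\<close>. The expression under the limit therefore equals \<open>F c\<close>, and as
  \<open>\<delta>\<close> tends to \<open>0\<close> it tends to the limit of \<open>F\<close>, whatever \<open>w\<close> is.
\<close>

lemma initialized_integral_eq:
  fixes g w :: "real \<Rightarrow> real"
  assumes w: "initialization_function w" and "0 < \<delta>"
    and int: "\<And>a. 0 < a \<Longrightarrow> a < \<delta> \<Longrightarrow> g integrable_on {a..\<delta>}"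
  obtains c where "0 < c" "c \<le> \<delta>"
    "((\<lambda>u. g u * w (u / \<delta>)) has_integral integral {c..\<delta>} g) {0..\<delta>}"
proof -
  obtain \<epsilon> where "mono w" and \<epsilon>: "0 < \<epsilon>" "\<epsilon> \<le> 1" "\<And>v. v < \<epsilon> \<Longrightarrow> w v = 0" "\<And>v. v \<ge> 1 \<Longrightarrow> w v = 1"
    using w unfolding initialization_function_def by blast
  \<comment> \<open>Half of \<epsilon> is taken because \<open>w\<close> may already be positive at
    \<epsilon> itself. Thus \<open>w (a / \<delta>) = 0\<close>, and \<open>a < \<delta>\<close>
    even when \<epsilon> is 1.\<close>
  define a where "a = \<epsilon> / 2 * \<delta>"
  have a: "0 < a" "a < \<delta>"
    using \<epsilon> \<open>0 < \<delta>\<close> by (auto simp: a_def)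
  have w0: "w (u / \<delta>) = 0" if "u \<le> a" for u
  proof -
    have "u / \<delta> \<le> \<epsilon> / 2"
      using that \<open>0 < \<delta>\<close> by (simp add: a_def field_simps)
    also have "\<dots> < \<epsilon>"
      using \<epsilon>(1) by simp
    finally show ?thesis
      by (rule \<epsilon>(3))
  qed
  have mono: "w (x / \<delta>) \<le> w (y / \<delta>)" if "a \<le> x" "x \<le> y" "y \<le> \<delta>" for x y
    using that \<open>0 < \<delta>\<close> by (intro monoD[OF \<open>mono w\<close>] divide_right_mono) auto
  obtain c where c: "c \<in> {a..\<delta>}"
    and hi: "((\<lambda>u. w (u / \<delta>) * g u) has_integral
      (w (a / \<delta>) * integral {a..c} g + w (\<delta> / \<delta>) * integral {c..\<delta>} g)) {a..\<delta>}"
    by (rule second_mean_value_theorem_full[where g = "\<lambda>u. w (u / \<delta>)",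
          OF int[OF a] less_imp_le[OF a(2)] mono])
  \<comment> \<open>The weight is 0 at \<open>a\<close> and 1 at \<delta>, so only the second of the
    two mean value terms survives.\<close>
  have "((\<lambda>u. g u * w (u / \<delta>)) has_integral integral {c..\<delta>} g) {a..\<delta>}"
    using hi w0[of a] \<epsilon>(4)[of 1] \<open>0 < \<delta>\<close> by (simp add: mult.commute)
  \<comment> \<open>Near 0 the function \<open>g\<close> need not be integrable, but the weight
    makes the product vanish identically there.\<close>
  moreover have "((\<lambda>u. g u * w (u / \<delta>)) has_integral 0) {0..a}"
    using w0 by (intro has_integral_is_0) auto
  ultimately have "((\<lambda>u. g u * w (u / \<delta>)) has_integral integral {c..\<delta>} g) {0..\<delta>}"
    using has_integral_combine[of 0 a \<delta> "\<lambda>u. g u * w (u / \<delta>)" 0 "integral {c..\<delta>} g"] a by simp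
  then show ?thesis
    using c a by (intro that[of c]) auto
qed

text \<open>Proving this for every \<open>w\<close>, not just one, serves twice: one choice of
  \<open>w\<close> gives existence, and the arbitrary one gives uniqueness of the value.\<close>

lemma has_Z_integral_via_of_improper:
  fixes g w :: "real \<Rightarrow> real"
  assumes w: "initialization_function w" and "\<beta> > 0"
    and int: "\<And>\<delta>. 0 < \<delta> \<Longrightarrow> \<delta> < \<beta> \<Longrightarrow> g integrable_on {\<delta>..\<beta>}"
    and lim: "((\<lambda>\<delta>. integral {\<delta>..\<beta>} g) \<longlongrightarrow> L) (at_right 0)"
  shows "has_Z_integral_via w \<beta> g L"
proof -
  have "\<forall>\<delta>\<in>{0<..<\<beta>}. \<exists>c. 0 < c \<and> c \<le> \<delta> \<and> (\<lambda>u. g u * w (u / \<delta>)) integrable_on {0..\<delta>} \<and>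
      integral {0..\<delta>} (\<lambda>u. g u * w (u / \<delta>)) + integral {\<delta>..\<beta>} g = integral {c..\<beta>} g"
  proof
    fix \<delta> assume "\<delta> \<in> {0<..<\<beta>}"
    then have \<delta>: "0 < \<delta>" "\<delta> < \<beta>"
      by auto
    have sub: "g integrable_on {a..\<delta>}" if "0 < a" "a < \<delta>" for a
      using integrable_subinterval_real[OF int[of a]] that \<delta> by simp
    obtain c where c: "0 < c" "c \<le> \<delta>"
      "((\<lambda>u. g u * w (u / \<delta>)) has_integral integral {c..\<delta>} g) {0..\<delta>}"
      by (rule initialized_integral_eq[where g = g, OF w \<delta>(1) sub])
    moreover have "integral {c..\<delta>} g + integral {\<delta>..\<beta>} g = integral {c..\<beta>} g"
      using c \<delta> int[of c] by (intro Henstock_Kurzweil_Integration.integral_combine) auto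
    ultimately show "\<exists>c. 0 < c \<and> c \<le> \<delta> \<and> (\<lambda>u. g u * w (u / \<delta>)) integrable_on {0..\<delta>} \<and>
        integral {0..\<delta>} (\<lambda>u. g u * w (u / \<delta>)) + integral {\<delta>..\<beta>} g = integral {c..\<beta>} g"
      by (intro exI[of _ c]) (auto simp: has_integral_iff)
  qed
  \<comment> \<open>Choosing \<open>c\<close> as a function of \<delta> writes the expression under
    the limit as the truncated integral composed with \<open>c\<close>.\<close>
  from bchoice[OF this] obtain c where c: "\<forall>\<delta>\<in>{0<..<\<beta>}. 0 < c \<delta> \<and> c \<delta> \<le> \<delta> \<and>
      (\<lambda>u. g u * w (u / \<delta>)) integrable_on {0..\<delta>} \<and>
      integral {0..\<delta>} (\<lambda>u. g u * w (u / \<delta>)) + integral {\<delta>..\<beta>} g = integral {c \<delta>..\<beta>} g" ..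
  have c_pos: "0 < c \<delta>" and c_le: "c \<delta> \<le> \<delta>" if "0 < \<delta> \<and> \<delta> < \<beta>" for \<delta>
    using bspec[OF c, of \<delta>] that by simp_all
  have ev: "\<forall>\<^sub>F \<delta> in at_right 0. 0 < \<delta> \<and> \<delta> < \<beta>"
    using \<open>\<beta> > 0\<close> by (auto simp: eventually_at_right_field)
  \<comment> \<open>The limit in \<open>lim\<close> is one-sided, so \<open>c\<close> must tend to 0
    through positive values; it is squeezed between 0 and \<delta>.\<close>
  have "filterlim c (at_right 0) (at_right 0)"
    unfolding filterlim_at
  proof
    show "\<forall>\<^sub>F \<delta> in at_right 0. c \<delta> \<in> {0<..} \<and> c \<delta> \<noteq> 0"
      using ev by eventually_elim (use c_pos in force)
    show "(c \<longlongrightarrow> 0) (at_right 0)"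
    proof (rule tendsto_sandwich)
      show "\<forall>\<^sub>F \<delta> in at_right 0. 0 \<le> c \<delta>"
        using ev by eventually_elim (rule less_imp_le[OF c_pos])
      show "\<forall>\<^sub>F \<delta> in at_right 0. c \<delta> \<le> \<delta>"
        using ev by eventually_elim (rule c_le)
    qed (rule tendsto_const tendsto_ident_at)+
  qed
  then have "((\<lambda>\<delta>. integral {c \<delta>..\<beta>} g) \<longlongrightarrow> L) (at_right 0)"
    by (rule filterlim_compose[OF lim])
  moreover have "\<forall>\<^sub>F \<delta> in at_right 0. integral {c \<delta>..\<beta>} g =
      integral {0..\<delta>} (\<lambda>u. g u * w (u / \<delta>)) + integral {\<delta>..\<beta>} g"
    using ev by eventually_elim (use c in force)
  ultimately have "((\<lambda>\<delta>. integral {0..\<delta>} (\<lambda>u. g u * w (u / \<delta>)) + integral {\<delta>..\<beta>} g) \<longlongrightarrow> L)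
      (at_right 0)"
    by (rule Lim_transform_eventually)
  moreover have "\<forall>\<^sub>F \<delta> in at_right 0. (\<lambda>u. g u * w (u / \<delta>)) integrable_on {0..\<delta>} \<and>
      g integrable_on {\<delta>..\<beta>}"
    using ev by eventually_elim (use c int in force)
  ultimately show ?thesis
    unfolding has_Z_integral_via_def by blast
qed

text \<open>This is the witness for existence: a unit jump at 1, with \<epsilon> = 1. Its weighted
  integral over \<open>{0..\<delta>}\<close> lives on the single point \<delta>, so the generalized
  integral reduces to the conventional one.\<close>

lemma initialization_function_step: "initialization_function (\<lambda>v. if v < 1 then 0 else 1)"
  unfolding initialization_function_def by (auto simp: mono_def intro!: exI[of _ 1])

theorem mainTheorem3:
  fixes \<beta> :: real and g :: "real \<Rightarrow> real"
  assumes "\<beta> > 0"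
    and "\<And>\<delta>. 0 < \<delta> \<Longrightarrow> \<delta> < \<beta> \<Longrightarrow> g integrable_on {\<delta>..\<beta>}"
    and "improper_integrable \<beta> g"
  shows "Z_integrable \<beta> g \<and> Z_integral \<beta> g = improper_integral \<beta> g"
proof -
  obtain L where L: "((\<lambda>\<delta>. integral {\<delta>..\<beta>} g) \<longlongrightarrow> L) (at_right 0)"
    using assms(3) unfolding improper_integrable_def by (elim conjE exE)
  have via: "has_Z_integral_via w \<beta> g L" if "initialization_function w" for w
    using has_Z_integral_via_of_improper[OF that assms(1,2) L] .
  \<comment> \<open>The definite description needs one value across all \<open>w\<close>. The
    \<open>w\<close> that produces \<open>L'\<close> also produces \<open>L\<close>, and both are
    limits of the same expression.\<close>
  have unique: "L' = L" if "initialization_function w" "has_Z_integral_via w \<beta> g L'" for w L'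
    using via[OF that(1)] that(2) unfolding has_Z_integral_via_def
    by (elim conjE) (rule tendsto_unique[OF trivial_limit_at_right_real])
  have ex: "\<exists>w. initialization_function w \<and> has_Z_integral_via w \<beta> g L"
    using initialization_function_step via[OF initialization_function_step] by (intro exI conjI)
  have "Z_integral \<beta> g = L"
    unfolding Z_integral_def using ex
    by (rule the_equality) (elim exE conjE, rule unique)
  moreover have "improper_integral \<beta> g = L"
    unfolding improper_integral_def using L by (intro tendsto_Lim) simp_all
  moreover have "Z_integrable \<beta> g"
    unfolding Z_integrable_def using ex by (elim exE) (intro exI)
  ultimately show ?thesis
    by simp
qed

end
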